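(* Fix $m,d\ge1$ and let $\beta_1,\dots,\beta_s$ be a spanning configuration in $(\mathbb C^d)^*$. The following are equivalent: (i) the $\beta_j$ have uniform maximal rank in dimension $d$; (ii) there is a configuration $\Lambda_1,\dots,\Lambda_{m+s}\in(\mathbb C^{m+d})^*$ of uniform maximal rank in the Poincaré domain and, for the support $I_0=\{1,\dots,m\}$, an identification $\mathfrak h_{I_0}\simeq\mathbb C^d$ under which the residual weights on the coordinates outside $I_0$ are exactly $\beta_1,\dots,\beta_s$, i.e. $\Lambda_{m+j}|_{\mathfrak h_{I_0}}=\beta_j$ for $1\le j\le s$.
   Context: A spanning configuration $\beta_1,\dots,\beta_s\in(\mathbb C^d)^*$ ($s\ge d$) has uniform maximal rank in dimension $d$ if $\dim\operatorname{Span}\{\beta_j:j\in K\}=\min\{|K|,d\}$ for every $K\subset\{1,\dots,s\}$. A configuration $\Lambda_1,\dots,\Lambda_n\in(\mathbb C^k)^*$ spanning $(\mathbb C^k)^*$ has uniform maximal rank if $\dim\operatorname{Span}\{\Lambda_i:i\in I\}=\min\{|I|,k\}$ for every $I\subset\{1,\dots,n\}$; it is in the Poincaré domain if there is $\xi\in\mathbb C^k$ with $\operatorname{Re}\Lambda_j(\xi)>0$ for every $j$. For $I\subset\{1,\dots,n\}$, $\mathfrak h_I=\bigcap_{i\in I}\ker\Lambda_i$, and the residual weights are the restrictions $\Lambda_j|_{\mathfrak h_I}$, $j\notin I$. *)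

theory Defs
  imports "HOL-Analysis.Analysis" "HOL-Library.Function_Algebras"
begin

text \<open>
  The elements of the dual of \<open>\<complex>\<^sup>k\<close> are the complex-linear functions on \<open>complex ^ 'k\<close>. They
  are regarded as vectors of the complex vector space of all functions \<open>complex ^ 'k \<Rightarrow> complex\<close>,
  with pointwise operations; spans and dimensions of families of functionals are taken there.
  A configuration of \<open>n\<close> functionals is a sequence of which only the entries with index in
  \<open>{1..n}\<close> matter.
\<close>

definition fun_scale :: "complex \<Rightarrow> ('a \<Rightarrow> complex) \<Rightarrow> 'a \<Rightarrow> complex" where
  "fun_scale c f = (\<lambda>x. c * f x)"

interpretation functional: vector_space fun_scale
  by unfold_locales (auto simp: fun_scale_def fun_eq_iff algebra_simps)

definition dual_space :: "(complex ^ 'k \<Rightarrow> complex) set" where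
  "dual_space = {f. Vector_Spaces.linear (*s) (*) f}"

definition spanning_configuration :: "nat \<Rightarrow> (nat \<Rightarrow> complex ^ 'k \<Rightarrow> complex) \<Rightarrow> bool" where
  "spanning_configuration n \<Lambda> \<longleftrightarrow>
     (\<forall>i\<in>{1..n}. \<Lambda> i \<in> dual_space) \<and> functional.span (\<Lambda> ` {1..n}) = dual_space"

definition uniform_maximal_rank :: "nat \<Rightarrow> (nat \<Rightarrow> complex ^ 'k \<Rightarrow> complex) \<Rightarrow> bool" where
  "uniform_maximal_rank n \<Lambda> \<longleftrightarrow>
     (\<forall>I\<subseteq>{1..n}. functional.dim (functional.span (\<Lambda> ` I)) = min (card I) CARD('k))"

definition poincare_domain :: "nat \<Rightarrow> (nat \<Rightarrow> complex ^ 'k \<Rightarrow> complex) \<Rightarrow> bool" where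
  "poincare_domain n \<Lambda> \<longleftrightarrow> (\<exists>\<xi>. \<forall>j\<in>{1..n}. Re (\<Lambda> j \<xi>) > 0)"

definition common_kernel :: "(nat \<Rightarrow> complex ^ 'k \<Rightarrow> complex) \<Rightarrow> nat set \<Rightarrow> (complex ^ 'k) set" where
  "common_kernel \<Lambda> I = (\<Inter>i\<in>I. {x. \<Lambda> i x = 0})"

text \<open>
  A linear isomorphism from \<open>\<complex>\<^sup>d\<close> onto a subspace of \<open>\<complex>\<^sup>k\<close>, given as a map into \<open>\<complex>\<^sup>k\<close>.
\<close>

definition linear_identification ::
  "(complex ^ 'd \<Rightarrow> complex ^ 'k) \<Rightarrow> (complex ^ 'k) set \<Rightarrow> bool" where
  "linear_identification \<phi> H \<longleftrightarrow>
     Vector_Spaces.linear (*s) (*s) \<phi> \<and> bij_betw \<phi> UNIV H"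

end

theory Submission imports Defs begin

text \<open>
  Uniform maximal rank says that every subfamily of at most \<open>k\<close> functionals is independent.

  A functional vanishing on the common kernel of \<open>\<Lambda>\<^sub>1, \<dots>, \<Lambda>\<^sub>m\<close> is a combination of them. So a
  linear relation among at most \<open>d\<close> residual weights lifts to one among at most \<open>m + d\<close> of the
  \<open>\<Lambda>\<^sub>i\<close>, and uniform maximal rank passes to the residual configuration.

  Conversely, on \<open>\<complex>\<^sup>m \<times> \<complex>\<^sup>d\<close> take the coordinate functionals \<open>e\<^sub>1, \<dots>, e\<^sub>m\<close> and
  \<open>\<Lambda>\<^sub>m\<^sub>+\<^sub>j = \<beta>\<^sub>j + \<Sum>\<^sub>i c\<^sub>i\<^sub>j e\<^sub>i\<close> with \<open>c\<^sub>i\<^sub>j > 0\<close>. The point \<open>(1, \<dots>, 1, 0)\<close> witnesses the Poincare domain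
  condition. The coefficients are chosen one \<open>j\<close> at a time, avoiding the finitely many spans of
  fewer than \<open>m + d\<close> earlier functionals. This is possible because no such span contains
  \<open>\<beta>\<^sub>j, e\<^sub>1, \<dots>, e\<^sub>m\<close> together: it would have to use all the \<open>e\<^sub>i\<close>, hence fewer than \<open>d\<close> of the
  others, and \<open>\<beta>\<^sub>j\<close> would depend on fewer than \<open>d\<close> of the earlier weights.
\<close>

section \<open>Independent families and avoidance of subspaces in an arbitrary vector space\<close>

context vector_space
begin

text \<open>Independence is stated for the indexed family, not for its image, because a repeated
  vector must count as a dependence: rank conditions compare with the number of indices.\<close>

definition independent_family :: "('i \<Rightarrow> 'b) \<Rightarrow> 'i set \<Rightarrow> bool" where
  "independent_family f I \<longleftrightarrow> (\<forall>i\<in>I. f i \<notin> span (f ` (I - {i})))"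

lemma independent_family_iff:
  "local.independent_family f I \<longleftrightarrow> inj_on f I \<and> independent (f ` I)"
proof
  assume fam: "local.independent_family f I"
  have "inj_on f I"
  proof (rule inj_onI, rule ccontr)
    fix i j assume "i \<in> I" "j \<in> I" "f i = f j" "i \<noteq> j"
    then have "f i \<in> f ` (I - {i})" by auto
    with fam \<open>i \<in> I\<close> show False
      by (auto simp: independent_family_def intro: span_base)
  qed
  moreover from this have "f ` (I - {i}) = f ` I - {f i}" if "i \<in> I" for i
    using that by (auto simp: inj_on_def)
  ultimately show "inj_on f I \<and> independent (f ` I)"
    using fam by (auto simp: independent_family_def dependent_def)
next
  assume r: "inj_on f I \<and> independent (f ` I)"
  then have "f ` (I - {i}) = f ` I - {f i}" if "i \<in> I" for i
    using that by (auto simp: inj_on_def)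
  with r show "local.independent_family f I"
    by (auto simp: independent_family_def dependent_def)
qed

lemma independent_family_mono:
  assumes "local.independent_family f I" "J \<subseteq> I"
  shows "local.independent_family f J"
  using assms by (meson independent_family_iff inj_on_subset independent_mono image_mono)

lemma independent_family_cong:
  assumes "\<And>i. i \<in> I \<Longrightarrow> f i = g i"
  shows "local.independent_family f I \<longleftrightarrow> local.independent_family g I"
proof -
  have "f ` I = g ` I" "inj_on f I = inj_on g I"
    using assms by (auto intro!: inj_on_cong)
  then show ?thesis by (simp add: independent_family_iff)
qed

lemma independent_family_insert:
  assumes "i \<notin> I"
  shows "local.independent_family f (insert i I) \<longleftrightarrow> local.independent_family f I \<and> f i \<notin> span (f ` I)"
proof -
  have "f i \<in> f ` I \<Longrightarrow> f i \<in> span (f ` I)"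
    by (rule span_base)
  then show ?thesis
    using assms by (auto simp: independent_family_iff independent_insert)
qed

text \<open>A basis chosen inside the image has \<open>dim\<close> elements, at most as many as the
  image, which has at most \<open>card I\<close>. If the dimension is \<open>card I\<close>, both
  bounds are equalities, so the image is its own basis and \<open>f\<close> is injective on
  \<open>I\<close>.\<close>

lemma independent_family_iff_dim:
  assumes "finite I"
  shows "local.independent_family f I \<longleftrightarrow> dim (f ` I) = card I"
proof
  assume "local.independent_family f I"
  then show "dim (f ` I) = card I"
    by (simp add: independent_family_iff dim_eq_card_independent card_image)
next
  assume dim: "dim (f ` I) = card I"
  have fin: "finite (f ` I)"
    using assms by simp
  obtain B where B: "B \<subseteq> f ` I" "independent B" "f ` I \<subseteq> span B"
    using maximal_independent_subset by blast
  have "card B = card I"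
    using B dim basis_card_eq_dim by metis
  moreover have "card B \<le> card (f ` I)" "card (f ` I) \<le> card I"
    using B(1) fin assms by (auto intro: card_mono card_image_le)
  ultimately have card: "card (f ` I) = card I" and "B = f ` I"
    using card_subset_eq[OF fin B(1)] by linarith+
  then show "local.independent_family f I"
    using B(2) eq_card_imp_inj_on[OF assms card] by (simp add: independent_family_iff)
qed

text \<open>A vector of \<open>span T\<close> outside \<open>span S\<close> would enlarge
  \<open>S\<close> to an independent subset of \<open>span T\<close> with more than
  \<open>card T\<close> elements.\<close>

lemma independent_span_eq:
  assumes "finite T" "independent S" "S \<subseteq> span T" "card S = card T"
  shows "span S = span T"
proof
  show "span S \<subseteq> span T"
    using assms by (simp add: span_minimal)
  show "span T \<subseteq> span S"
  proof
    fix x assume x: "x \<in> span T"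
    show "x \<in> span S"
    proof (rule ccontr)
      assume "x \<notin> span S"
      then have "independent (insert x S)" "x \<notin> S"
        using assms(2) independent_insertI span_base by blast+
      moreover have "insert x S \<subseteq> span T"
        using assms(3) x by simp
      ultimately show False
        using independent_span_bound[OF assms(1), of "insert x S"]
          independent_span_bound[OF assms(1-3)] assms(4) by auto
    qed
  qed
qed

text \<open>
  Each coefficient in turn excludes at most one value per subspace: two bad values would put
  \<open>e i\<close>, and then everything else, into the subspace.
\<close>

lemma avoid_subspaces:
  assumes "finite I" "infinite T" "finite F"
    and "\<And>U. U \<in> F \<Longrightarrow> subspace U"
    and "\<And>U. U \<in> F \<Longrightarrow> v \<notin> U \<or> (\<exists>i\<in>I. e i \<notin> U)"
  shows "\<exists>c. (\<forall>i\<in>I. c i \<in> T) \<and> (\<forall>U\<in>F. v + (\<Sum>i\<in>I. scale (c i) (e i)) \<notin> U)"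
  using assms(1,3-)
proof (induction I arbitrary: F rule: finite_induct)
  case empty
  then show ?case by auto
next
  case (insert i I)
  \<comment> \<open>\<open>G\<close> collects the subspaces that the earlier coefficients can avoid.
    A member of \<open>F\<close> outside \<open>G\<close> contains \<open>v\<close> and every
    earlier \<open>e j\<close>, so by hypothesis it misses \<open>e i\<close>, and at most one value
    of the new coefficient is bad for it.\<close>
  define G where "G = {U \<in> F. v \<notin> U \<or> (\<exists>j\<in>I. e j \<notin> U)}"
  have "\<exists>c. (\<forall>i\<in>I. c i \<in> T) \<and> (\<forall>U\<in>G. v + (\<Sum>i\<in>I. scale (c i) (e i)) \<notin> U)"
  proof (rule insert.IH)
    show "finite G"
      using insert.prems(1) by (simp add: G_def)
  qed (use insert.prems(2) in \<open>simp_all add: G_def\<close>)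
  then obtain c where c: "\<forall>j\<in>I. c j \<in> T"
    and cG: "\<forall>U\<in>G. v + (\<Sum>i\<in>I. scale (c i) (e i)) \<notin> U"
    by (elim exE conjE)
  define w where "w = v + (\<Sum>i\<in>I. scale (c i) (e i))"
  have unique: "t = t'"
    if U: "U \<in> F" and t: "w + scale t (e i) \<in> U" "w + scale t' (e i) \<in> U" for U t t'
  proof (rule ccontr)
    assume "t \<noteq> t'"
    have sub: "subspace U"
      using U insert.prems by blast
    have "scale (t - t') (e i) \<in> U"
      using subspace_diff[OF sub t] by (simp add: scale_left_diff_distrib)
    from subspace_scale[OF sub this, of "inverse (t - t')"] \<open>t \<noteq> t'\<close> have ei: "e i \<in> U"
      by simp
    then have "w \<in> U"
      using subspace_diff[OF sub t(1) subspace_scale[OF sub ei, of t]] by simp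
    moreover have "U \<in> G"
      using insert.prems(3)[OF U] ei U by (auto simp: G_def)
    ultimately show False
      using cG w_def by blast
  qed
  have "finite {t. w + scale t (e i) \<in> U}" if "U \<in> F" for U
  proof (cases "\<exists>t. w + scale t (e i) \<in> U")
    case True
    then obtain t where "w + scale t (e i) \<in> U" by blast
    then have "{t. w + scale t (e i) \<in> U} \<subseteq> {t}"
      using unique[OF that] by blast
    then show ?thesis by (rule finite_subset) simp
  qed simp
  then have "finite (\<Union>U\<in>F. {t. w + scale t (e i) \<in> U})"
    using insert.prems(1) by blast
  with assms(2) obtain t where "t \<in> T" "t \<notin> (\<Union>U\<in>F. {t. w + scale t (e i) \<in> U})"
    by (meson finite_subset subsetI)
  moreover have "v + (\<Sum>j\<in>insert i I. scale ((c(i := t)) j) (e j)) = w + scale t (e i)"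
  proof -
    have "(\<Sum>j\<in>I. scale ((c(i := t)) j) (e j)) = (\<Sum>j\<in>I. scale (c j) (e j))"
      using insert.hyps by (intro sum.cong) auto
    then show ?thesis
      using insert.hyps by (simp add: w_def algebra_simps)
  qed
  ultimately show ?case
    using c by (intro exI[of _ "c(i := t)"]) auto
qed

end

section \<open>The dual space and its coordinate basis\<close>

lemma dual_space_iff:
  "f \<in> dual_space \<longleftrightarrow> (\<forall>x y. f (x + y) = f x + f y) \<and> (\<forall>c x. f (c *s x) = c * f x)"
proof -
  have "vector_space ((*s) :: complex \<Rightarrow> complex ^ 'a \<Rightarrow> complex ^ 'a)"
    "vector_space ((*) :: complex \<Rightarrow> complex \<Rightarrow> complex)"
    by unfold_locales (auto simp: algebra_simps vector_add_ldistrib vector_sadd_rdistrib)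
  then show ?thesis
    by (auto simp: dual_space_def Vector_Spaces.linear_iff)
qed

lemma subspace_dual_space: "functional.subspace dual_space"
  unfolding functional.subspace_def
  by (auto simp: dual_space_iff fun_scale_def algebra_simps)

lemma dual_space_zero: "f 0 = 0" if "f \<in> dual_space"
  using that unfolding dual_space_iff by (metis add_cancel_right_right add_0)

lemma dual_space_diff: "f (x - y) = f x - f y" if "f \<in> dual_space"
  using that unfolding dual_space_iff by (metis add_diff_cancel diff_add_cancel)

lemma coordinate_mem_dual_space: "(\<lambda>x. x $ i) \<in> dual_space"
  by (simp add: dual_space_iff)

lemma sum_fun_apply: "(\<Sum>i\<in>A. f i) x = (\<Sum>i\<in>A. f i x)"
  for f :: "'i \<Rightarrow> 'a \<Rightarrow> 'b::comm_monoid_add"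
  by (induction A rule: infinite_finite_induct) auto

lemma span_coordinates:
  "functional.span (range (\<lambda>i (x :: complex ^ 'k). x $ i)) = dual_space"
proof
  show "functional.span (range (\<lambda>i (x :: complex ^ 'k). x $ i)) \<subseteq> dual_space"
    by (intro functional.span_minimal subspace_dual_space) (auto simp: coordinate_mem_dual_space)
  show "dual_space \<subseteq> functional.span (range (\<lambda>i (x :: complex ^ 'k). x $ i))"
  proof
    fix f :: "complex ^ 'k \<Rightarrow> complex"
    assume f: "f \<in> dual_space"
    have *: "f (\<Sum>i\<in>A. g i) = (\<Sum>i\<in>A. f (g i))" for A :: "'k set" and g
      using f by (induction A rule: infinite_finite_induct)
        (auto simp: dual_space_zero dual_space_iff)
    have "f = (\<Sum>i\<in>UNIV. fun_scale (f (axis i 1)) (\<lambda>x. x $ i))"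
    proof
      fix x :: "complex ^ 'k"
      have "f x = f (\<Sum>i\<in>UNIV. x $ i *s axis i 1)"
        by (simp add: basis_expansion)
      also have "\<dots> = (\<Sum>i\<in>UNIV. x $ i * f (axis i 1))"
        using f by (simp add: * dual_space_iff)
      finally show "f x = (\<Sum>i\<in>UNIV. fun_scale (f (axis i 1)) (\<lambda>x. x $ i)) x"
        by (simp add: sum_fun_apply fun_scale_def mult.commute)
    qed
    then show "f \<in> functional.span (range (\<lambda>i x. x $ i))"
      by (metis (mono_tags, lifting) functional.span_sum functional.span_scale functional.span_base rangeI)
  qed
qed

lemma inj_coordinates: "inj (\<lambda>i (x :: complex ^ 'k). x $ i)"
proof (rule injI)
  fix i j :: 'k assume "(\<lambda>x :: complex ^ 'k. x $ i) = (\<lambda>x. x $ j)"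
  then have "axis i (1 :: complex) $ i = axis i 1 $ j" by metis
  then show "i = j" by (auto simp: axis_def split: if_splits)
qed

text \<open>Evaluation at \<open>axis i 1\<close> kills every other coordinate functional, hence
  their span, but not the \<open>i\<close>-th one.\<close>

lemma independent_family_coordinates:
  "functional.independent_family (\<lambda>i (x :: complex ^ 'k). x $ i) I"
  unfolding functional.independent_family_def
proof (intro ballI notI)
  fix i :: 'k assume "(\<lambda>x. x $ i) \<in> functional.span ((\<lambda>i (x :: complex ^ 'k). x $ i) ` (I - {i}))"
  moreover have "functional.span ((\<lambda>i (x :: complex ^ 'k). x $ i) ` (I - {i})) \<subseteq> {f. f (axis i 1) = 0}"
    by (intro functional.span_minimal)
      (auto simp: functional.subspace_def fun_scale_def axis_def)
  ultimately show False by (auto simp: axis_def)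
qed

section \<open>Spanning families of functionals and uniform maximal rank\<close>

lemma span_eq_dual_space:
  fixes S :: "(complex ^ 'k \<Rightarrow> complex) set"
  assumes "\<not> functional.dependent S" "S \<subseteq> dual_space" "card S = CARD('k)"
  shows "functional.span S = dual_space"
proof -
  have "card (range (\<lambda>i (x :: complex ^ 'k). x $ i)) = CARD('k)"
    by (rule card_image[OF inj_coordinates])
  then show ?thesis
    using functional.independent_span_eq[of "range (\<lambda>i x. x $ i)" S] assms
    by (simp add: span_coordinates)
qed

lemma span_image_eq_dual_space:
  fixes \<Lambda> :: "nat \<Rightarrow> complex ^ 'k \<Rightarrow> complex"
  assumes "\<forall>i\<in>{1..n}. \<Lambda> i \<in> dual_space"
    and "J \<subseteq> I" "I \<subseteq> {1..n}" "card J = CARD('k)" "functional.independent_family \<Lambda> J"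
  shows "functional.span (\<Lambda> ` I) = dual_space"
proof
  show "functional.span (\<Lambda> ` I) \<subseteq> dual_space"
    using assms(1,3) by (intro functional.span_minimal subspace_dual_space) auto
  have "functional.span (\<Lambda> ` J) = dual_space"
    using assms by (intro span_eq_dual_space)
      (auto simp: functional.independent_family_iff card_image)
  then show "dual_space \<subseteq> functional.span (\<Lambda> ` I)"
    using functional.span_mono[of "\<Lambda> ` J" "\<Lambda> ` I"] assms(2) by blast
qed

text \<open>For \<open>card I\<close> at most the dimension, the rank condition is independence. A
  larger \<open>I\<close> contains \<open>CARD('k)\<close> independent functionals, which already
  span the dual, so its rank is forced.\<close>

lemma uniform_maximal_rank_iff:
  fixes \<Lambda> :: "nat \<Rightarrow> complex ^ 'k \<Rightarrow> complex"
  assumes "\<forall>i\<in>{1..n}. \<Lambda> i \<in> dual_space"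
  shows "uniform_maximal_rank n \<Lambda> \<longleftrightarrow>
    (\<forall>I\<subseteq>{1..n}. card I \<le> CARD('k) \<longrightarrow> functional.independent_family \<Lambda> I)"
proof
  assume "uniform_maximal_rank n \<Lambda>"
  then show "\<forall>I\<subseteq>{1..n}. card I \<le> CARD('k) \<longrightarrow> functional.independent_family \<Lambda> I"
    using finite_subset[OF _ finite_atLeastAtMost[of 1 n]]
    by (simp add: uniform_maximal_rank_def functional.independent_family_iff_dim)
next
  assume r: "\<forall>I\<subseteq>{1..n}. card I \<le> CARD('k) \<longrightarrow> functional.independent_family \<Lambda> I"
  show "uniform_maximal_rank n \<Lambda>"
    unfolding uniform_maximal_rank_def
  proof (intro allI impI)
    fix I assume I: "I \<subseteq> {1..n}"
    then have "finite I" by (rule finite_subset) simp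
    show "functional.dim (functional.span (\<Lambda> ` I)) = min (card I) CARD('k)"
    proof (cases "card I \<le> CARD('k)")
      case True
      with r I have "functional.independent_family \<Lambda> I" by blast
      with True \<open>finite I\<close> show ?thesis
        by (simp add: functional.independent_family_iff_dim)
    next
      case False
      then obtain J where J: "J \<subseteq> I" "card J = CARD('k)" "finite J"
        by (metis obtain_subset_with_card_n nat_le_linear)
      then have fam: "functional.independent_family \<Lambda> J"
        using r I by simp
      have "functional.span (\<Lambda> ` I) = functional.span (\<Lambda> ` J)"
        using span_image_eq_dual_space[OF assms J(1) I J(2) fam]
          span_image_eq_dual_space[OF assms order_refl subset_trans[OF J(1) I] J(2) fam] by simp
      then have "functional.dim (functional.span (\<Lambda> ` I)) = functional.dim (functional.span (\<Lambda> ` J))"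
        by simp
      also have "\<dots> = card J"
        using fam J(3) by (simp add: functional.independent_family_iff_dim)
      finally show ?thesis
        using J False by simp
    qed
  qed
qed

section \<open>From the large configuration to its residual weights\<close>

text \<open>Induction on \<open>I\<close>. If \<open>\<Lambda> i\<close> is nonzero at some
  \<open>x\<close> in the common kernel of the earlier functionals, subtracting a multiple of
  \<open>\<Lambda> i\<close> makes \<open>f\<close> vanish at \<open>x\<close>, and then on that
  whole kernel. Otherwise adding \<open>\<Lambda> i\<close> does not shrink the kernel.\<close>

lemma vanishing_on_kernels_imp_span:
  assumes "finite I" "\<forall>i\<in>I. \<Lambda> i \<in> dual_space" "f \<in> dual_space"
    and "\<forall>x\<in>common_kernel \<Lambda> I. f x = 0"
  shows "f \<in> functional.span (\<Lambda> ` I)"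
  using assms
proof (induction I arbitrary: f rule: finite_induct)
  case empty
  then have "f = 0" by (auto simp: common_kernel_def)
  then show ?case by (simp only: functional.span_zero)
next
  case (insert i I)
  show ?case
  proof (cases "\<exists>x\<in>common_kernel \<Lambda> I. \<Lambda> i x \<noteq> 0")
    case True
    then obtain x where x: "x \<in> common_kernel \<Lambda> I" "\<Lambda> i x \<noteq> 0" by blast
    define g where "g = f - fun_scale (f x / \<Lambda> i x) (\<Lambda> i)"
    have "g \<in> functional.span (\<Lambda> ` I)"
    proof (rule insert.IH)
      show "g \<in> dual_space"
        unfolding g_def using insert.prems
        by (intro functional.subspace_diff functional.subspace_scale subspace_dual_space) auto
      show "\<forall>y\<in>common_kernel \<Lambda> I. g y = 0"
      proof
        fix y assume y: "y \<in> common_kernel \<Lambda> I"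
        \<comment> \<open>\<open>z\<close> is the projection of \<open>y\<close> along
          \<open>x\<close> to the kernel of \<open>\<Lambda> i\<close>; it stays in the earlier
          kernels because \<open>x\<close> and \<open>y\<close> lie there.\<close>
        define z where "z = y - (\<Lambda> i y / \<Lambda> i x) *s x"
        have lin: "h z = h y - \<Lambda> i y / \<Lambda> i x * h x" if "h \<in> dual_space" for h
          using that dual_space_diff[OF that] by (simp add: z_def dual_space_iff)
        have "z \<in> common_kernel \<Lambda> (insert i I)"
          using x y insert.prems(1) by (auto simp: common_kernel_def lin)
        then have "f z = 0"
          using insert.prems by blast
        then show "g y = 0"
          using lin[OF insert.prems(2)] by (simp add: g_def fun_scale_def field_simps)
      qed
    qed (use insert.prems in auto)
    then show ?thesis
      by (auto simp: g_def functional.span_insert)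
  next
    case False
    then have "common_kernel \<Lambda> (insert i I) = common_kernel \<Lambda> I"
      by (auto simp: common_kernel_def)
    then have "f \<in> functional.span (\<Lambda> ` I)"
      using insert by simp
    then show ?thesis
      using functional.span_mono[of "\<Lambda> ` I" "\<Lambda> ` insert i I"] by blast
  qed
qed

text \<open>Composition with \<open>\<phi>\<close> models restriction to the common kernel; its
  linearity in the functional carries linear relations over to the restrictions.\<close>

lemma linear_pullback: "Vector_Spaces.linear fun_scale fun_scale (\<lambda>f. f \<circ> \<phi>)"
  by (auto simp: Vector_Spaces.linear_iff fun_eq_iff fun_scale_def functional.vector_space_axioms)

lemma span_pullback:
  "functional.span ((\<lambda>f. f \<circ> \<phi>) ` S) = (\<lambda>f. f \<circ> \<phi>) ` functional.span S"
  using module_hom.span_image linear_pullback module_hom_iff_linear by blast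

lemma uniform_maximal_rank_residual:
  fixes \<beta> :: "nat \<Rightarrow> complex ^ 'd \<Rightarrow> complex" and \<Lambda> :: "nat \<Rightarrow> complex ^ 'k \<Rightarrow> complex"
  assumes card_k: "CARD('k) = m + CARD('d)"
    and beta: "\<forall>j\<in>{1..s}. \<beta> j \<in> dual_space"
    and Lam: "\<forall>i\<in>{1..m + s}. \<Lambda> i \<in> dual_space"
    and umr: "uniform_maximal_rank (m + s) \<Lambda>"
    and phi: "common_kernel \<Lambda> {1..m} \<subseteq> range \<phi>"
    and res: "\<forall>j\<in>{1..s}. \<forall>x. \<Lambda> (m + j) (\<phi> x) = \<beta> j x"
  shows "uniform_maximal_rank s \<beta>"
  unfolding uniform_maximal_rank_iff[OF beta]
proof (intro allI impI)
  fix K assume K: "K \<subseteq> {1..s}" "card K \<le> CARD('d)"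
  then have "finite K" by (meson finite_subset finite_atLeastAtMost)
  show "functional.independent_family \<beta> K"
    unfolding functional.independent_family_def
  proof (intro ballI notI)
    fix i assume i: "i \<in> K" and dep: "\<beta> i \<in> functional.span (\<beta> ` (K - {i}))"
    define X where "X = \<Lambda> ` (+) m ` (K - {i})"
    have pull: "\<beta> j = \<Lambda> (m + j) \<circ> \<phi>" if "j \<in> K" for j
      using res K that by (auto simp: fun_eq_iff)
    have "\<beta> ` (K - {i}) = (\<lambda>f. f \<circ> \<phi>) ` X"
      unfolding X_def image_image by (intro image_cong) (auto simp: pull)
    \<comment> \<open>\<open>f\<close> lifts the relation: it combines the large functionals with
      indices shifted from \<open>K - {i}\<close> and agrees with \<open>\<Lambda> (m + i)\<close>
      after restriction.\<close>
    then obtain f where f: "f \<in> functional.span X" "\<Lambda> (m + i) \<circ> \<phi> = f \<circ> \<phi>"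
      using dep pull[OF i] by (auto simp: span_pullback)
    have "functional.span X \<subseteq> dual_space"
      using Lam K by (intro functional.span_minimal subspace_dual_space) (auto simp: X_def)
    moreover have "\<Lambda> (m + i) \<in> dual_space"
      using Lam K i by auto
    ultimately have "\<Lambda> (m + i) - f \<in> dual_space"
      using f by (intro functional.subspace_diff subspace_dual_space) auto
    \<comment> \<open>The difference vanishes on \<open>range \<phi>\<close>, which covers the
      common kernel.\<close>
    moreover have "\<forall>x\<in>common_kernel \<Lambda> {1..m}. (\<Lambda> (m + i) - f) x = 0"
      using f(2) phi by (auto simp: fun_eq_iff)
    ultimately have "\<Lambda> (m + i) - f \<in> functional.span (\<Lambda> ` {1..m})"
      using Lam by (intro vanishing_on_kernels_imp_span) auto
    then have "(\<Lambda> (m + i) - f) + f \<in> functional.span (\<Lambda> ` ({1..m} \<union> (+) m ` (K - {i})))"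
      using f(1) functional.span_mono[of "\<Lambda> ` {1..m}" "\<Lambda> ` ({1..m} \<union> (+) m ` (K - {i}))"]
        functional.span_mono[of X "\<Lambda> ` ({1..m} \<union> (+) m ` (K - {i}))"]
      by (intro functional.span_add) (auto simp: X_def)
    \<comment> \<open>The lifted relation involves at most \<open>m + card K\<close> indices, which
      is within \<open>CARD('k)\<close>, so uniform maximal rank forbids it.\<close>
    moreover have "functional.independent_family \<Lambda> ({1..m} \<union> (+) m ` K)"
    proof -
      have "card ({1..m} \<union> (+) m ` K) \<le> m + card K"
        using card_Un_le[of "{1..m}" "(+) m ` K"] by (simp add: card_image)
      then have "card ({1..m} \<union> (+) m ` K) \<le> CARD('k)"
        using K(2) card_k by linarith
      moreover have "{1..m} \<union> (+) m ` K \<subseteq> {1..m + s}"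
        using K(1) by auto
      ultimately show ?thesis
        using umr unfolding uniform_maximal_rank_iff[OF Lam] by blast
    qed
    moreover have "m + i \<in> {1..m} \<union> (+) m ` K"
      using i by blast
    moreover have "({1..m} \<union> (+) m ` K) - {m + i} = {1..m} \<union> (+) m ` (K - {i})"
      using K i by auto
    ultimately show False
      unfolding functional.independent_family_def by (metis diff_add_cancel)
  qed
qed

section \<open>Generic extension of a configuration of uniform maximal rank\<close>

text \<open>Induction on \<open>n\<close>, adding one functional at a time. Pulling back along
  \<open>\<phi>\<close> kills each \<open>e i\<close> and turns each new functional into
  \<open>\<beta> j\<close>, so independence of the \<open>\<beta> j\<close> shows that no span to be
  avoided contains all admissible candidates. \<open>T\<close> will be the positive reals.\<close>

lemma generic_extension:
  fixes e :: "nat \<Rightarrow> complex ^ 'k \<Rightarrow> complex" and B :: "nat \<Rightarrow> complex ^ 'k \<Rightarrow> complex"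
    and \<phi> :: "complex ^ 'd \<Rightarrow> complex ^ 'k"
  assumes card_k: "CARD('k) = m + CARD('d)"
    and e: "functional.independent_family e {1..m}"
    and e_phi: "\<And>i. i \<in> {1..m} \<Longrightarrow> e i \<circ> \<phi> = 0"
    and B_phi: "\<And>j. j \<in> {1..s} \<Longrightarrow> B j \<circ> \<phi> = \<beta> j"
    and beta: "\<And>K. K \<subseteq> {1..s} \<Longrightarrow> card K \<le> CARD('d) \<Longrightarrow> functional.independent_family \<beta> K"
    and T: "infinite T"
    and "n \<le> s"
  shows "\<exists>\<Lambda>. (\<forall>i\<in>{1..m}. \<Lambda> i = e i) \<and>
    (\<forall>j\<in>{1..n}. \<exists>c. (\<forall>i\<in>{1..m}. c i \<in> T) \<and> \<Lambda> (m + j) = B j + (\<Sum>i\<in>{1..m}. fun_scale (c i) (e i))) \<and>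
    (\<forall>I\<subseteq>{1..m + n}. card I \<le> CARD('k) \<longrightarrow> functional.independent_family \<Lambda> I)"
  using \<open>n \<le> s\<close>
proof (induction n)
  case 0
  then show ?case
    using e functional.independent_family_mono by (intro exI[of _ e]) auto
next
  case (Suc n)
  have "n \<le> s" using Suc.prems by simp
  from Suc.IH[OF this] obtain \<Lambda> where IH: "\<forall>i\<in>{1..m}. \<Lambda> i = e i"
    "\<forall>j\<in>{1..n}. \<exists>c. (\<forall>i\<in>{1..m}. c i \<in> T) \<and>
        \<Lambda> (m + j) = B j + (\<Sum>i\<in>{1..m}. fun_scale (c i) (e i))"
    "\<forall>I\<subseteq>{1..m + n}. card I \<le> CARD('k) \<longrightarrow> functional.independent_family \<Lambda> I"
    by (elim exE conjE)
  note base = IH(1)[rule_format] and shape = IH(2)[rule_format] and fam = IH(3)[rule_format]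
  \<comment> \<open>The bound is strict because an index set of size at most \<open>CARD('k)\<close>
    that contains the new index leaves fewer than \<open>CARD('k)\<close> old ones.\<close>
  define KK where "KK = {K. K \<subseteq> {1..m + n} \<and> card K < CARD('k)}"
  define F where "F = (\<lambda>K. functional.span (\<Lambda> ` K)) ` KK"
  have "finite KK"
    by (rule finite_subset[of _ "Pow {1..m + n}"]) (auto simp: KK_def)
  have not_sub: "B (Suc n) \<notin> functional.span (\<Lambda> ` K) \<or> (\<exists>i\<in>{1..m}. e i \<notin> functional.span (\<Lambda> ` K))"
    if "K \<in> KK" for K
  proof (rule ccontr)
    assume "\<not> ?thesis"
    then have B_in: "B (Suc n) \<in> functional.span (\<Lambda> ` K)"
      and e_in: "\<And>i. i \<in> {1..m} \<Longrightarrow> e i \<in> functional.span (\<Lambda> ` K)" by auto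
    have K: "K \<subseteq> {1..m + n}" "card K < CARD('k)" "finite K"
      using that finite_subset[of K] by (auto simp: KK_def)
    \<comment> \<open>If \<open>i\<close> were missing, \<open>insert i K\<close> would still have
      at most \<open>CARD('k)\<close> indices and be independent, although
      \<open>\<Lambda> i = e i\<close> lies in the span over \<open>K\<close>.\<close>
    have "i \<in> K" if i: "i \<in> {1..m}" for i
    proof (rule ccontr)
      assume "i \<notin> K"
      moreover have "functional.independent_family \<Lambda> (insert i K)"
        using K i \<open>i \<notin> K\<close> by (intro fam) auto
      ultimately show False
        using e_in[OF i] base[OF i] by (simp add: functional.independent_family_insert)
    qed
    then have mK: "{1..m} \<subseteq> K" by blast
    \<comment> \<open>Since \<open>K\<close> contains all of \<open>{1..m}\<close>, fewer than
      \<open>CARD('d)\<close> indices remain for \<open>L\<close>, which leaves room to adjoin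
      \<open>Suc n\<close> in the hypothesis on \<open>\<beta>\<close>.\<close>
    define L where "L = {j \<in> {1..n}. m + j \<in> K}"
    have K_eq: "K = {1..m} \<union> (+) m ` L"
    proof
      show "K \<subseteq> {1..m} \<union> (+) m ` L"
      proof
        fix k assume k: "k \<in> K"
        show "k \<in> {1..m} \<union> (+) m ` L"
        proof (cases "k \<le> m")
          case True
          then show ?thesis using k K(1) by auto
        next
          case False
          then have "k = m + (k - m)" "k - m \<in> L"
            using k K(1) by (auto simp: L_def)
          then show ?thesis by blast
        qed
      qed
    qed (use mK in \<open>auto simp: L_def\<close>)
    have "card K = m + card L"
      unfolding K_eq by (subst card_Un_disjoint) (auto simp: L_def card_image)
    then have "card L < CARD('d)"
      using K(2) card_k by simp
    moreover have "Suc n \<notin> L" "finite L" by (auto simp: L_def)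
    ultimately have "functional.independent_family \<beta> (insert (Suc n) L)"
      using Suc.prems by (intro beta) (auto simp: L_def)
    then have indep: "\<beta> (Suc n) \<notin> functional.span (\<beta> ` L)"
      using \<open>Suc n \<notin> L\<close> by (simp add: functional.independent_family_insert)
    have Lam_phi: "\<Lambda> (m + j) \<circ> \<phi> = \<beta> j" if "j \<in> L" for j
    proof -
      have j: "j \<in> {1..n}" using that by (simp add: L_def)
      obtain c where c: "\<Lambda> (m + j) = B j + (\<Sum>i\<in>{1..m}. fun_scale (c i) (e i))"
        using shape[OF j] by blast
      show ?thesis
      proof
        fix x
        have "e i (\<phi> x) = 0" if "i \<in> {1..m}" for i
          using fun_cong[OF e_phi[OF that], of x] by simp
        moreover have "B j (\<phi> x) = \<beta> j x"
          using fun_cong[OF B_phi[of j], of x] j Suc.prems by simp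
        ultimately show "(\<Lambda> (m + j) \<circ> \<phi>) x = \<beta> j x"
          by (simp add: c sum_fun_apply fun_scale_def)
      qed
    qed
    \<comment> \<open>Under pullback the \<open>e i\<close> contribute only 0, so the assumed
      membership of \<open>B (Suc n)\<close> becomes a dependence of \<open>\<beta> (Suc n)\<close>
      on the weights over \<open>L\<close>.\<close>
    have "(\<lambda>f. f \<circ> \<phi>) ` \<Lambda> ` K \<subseteq> insert 0 (\<beta> ` L)"
      unfolding K_eq using base e_phi Lam_phi by auto
    then have sub: "functional.span ((\<lambda>f. f \<circ> \<phi>) ` \<Lambda> ` K) \<subseteq> functional.span (\<beta> ` L)"
      using functional.span_mono[of _ "insert 0 (\<beta> ` L)"]
      by (simp only: functional.span_insert_0)
    have "B (Suc n) \<circ> \<phi> \<in> functional.span ((\<lambda>f. f \<circ> \<phi>) ` \<Lambda> ` K)"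
      unfolding span_pullback using B_in by (rule imageI)
    moreover have "B (Suc n) \<circ> \<phi> = \<beta> (Suc n)"
      using Suc.prems by (intro B_phi) simp
    ultimately show False
      using indep sub by auto
  qed
  have "\<exists>c. (\<forall>i\<in>{1..m}. c i \<in> T) \<and>
      (\<forall>U\<in>F. B (Suc n) + (\<Sum>i\<in>{1..m}. fun_scale (c i) (e i)) \<notin> U)"
    using not_sub \<open>finite KK\<close> T
    by (intro functional.avoid_subspaces) (auto simp: F_def)
  then obtain c where c: "\<forall>i\<in>{1..m}. c i \<in> T"
    and avoid: "\<forall>U\<in>F. B (Suc n) + (\<Sum>i\<in>{1..m}. fun_scale (c i) (e i)) \<notin> U"
    by (elim exE conjE)
  define M where "M = \<Lambda>(Suc (m + n) := B (Suc n) + (\<Sum>i\<in>{1..m}. fun_scale (c i) (e i)))"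
  have M_old: "M i = \<Lambda> i" if "i \<le> m + n" for i
    using that by (simp add: M_def)
  have "functional.independent_family M I"
    if I: "I \<subseteq> {1..m + Suc n}" "card I \<le> CARD('k)" for I
  proof -
    define K where "K = I - {Suc (m + n)}"
    have "finite I" using I(1) by (rule finite_subset) simp
    have K: "K \<subseteq> {1..m + n}" "card K \<le> card I"
      using I \<open>finite I\<close> by (auto simp: K_def card_Diff1_le)
    have M_K: "M i = \<Lambda> i" if "i \<in> K" for i
      using K that by (intro M_old) auto
    have "functional.independent_family \<Lambda> K"
      using K(2) I(2) by (intro fam[OF K(1)]) linarith
    then have famK: "functional.independent_family M K"
      using functional.independent_family_cong[of K M \<Lambda>] M_K by blast
    show ?thesis
    proof (cases "Suc (m + n) \<in> I")
      \<comment> \<open>The remaining indices form a member of \<open>KK\<close>, whose span was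
        avoided by the choice of \<open>c\<close>.\<close>
      case True
      then have I_eq: "I = insert (Suc (m + n)) K" and "card K < card I"
        using card_Diff1_less[OF \<open>finite I\<close> True] by (auto simp: K_def)
      then have "K \<in> KK"
        using I K by (simp add: KK_def)
      moreover have "M ` K = \<Lambda> ` K"
        using M_K by simp
      ultimately have "M (Suc (m + n)) \<notin> functional.span (M ` K)"
        using avoid by (auto simp: F_def M_def)
      moreover have "Suc (m + n) \<notin> K"
        by (simp add: K_def)
      ultimately show ?thesis
        using famK unfolding I_eq by (simp add: functional.independent_family_insert)
    next
      case False
      then show ?thesis using famK by (simp add: K_def)
    qed
  qed
  moreover have "\<exists>c. (\<forall>i\<in>{1..m}. c i \<in> T) \<and>
      M (m + j) = B j + (\<Sum>i\<in>{1..m}. fun_scale (c i) (e i))" if "j \<in> {1..Suc n}" for j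
  proof (cases "j = Suc n")
    case True
    then show ?thesis using c by (auto simp: M_def)
  next
    case False
    then have "j \<in> {1..n}" using that by auto
    then show ?thesis using shape[of j] M_old[of "m + j"] by simp
  qed
  moreover have "M i = e i" if "i \<in> {1..m}" for i
    using base[OF that] M_old[of i] that by simp
  ultimately show ?case
    by (intro exI[of _ M] conjI allI ballI impI)
qed

section \<open>The equivalence, with the extension realised in coordinates\<close>

theorem theorem4p3:
  fixes m s :: nat
    and \<beta> :: "nat \<Rightarrow> complex ^ 'd \<Rightarrow> complex"
  assumes "m \<ge> 1"
    and "CARD('k::finite) = m + CARD('d)"
    and "s \<ge> CARD('d)"
    and "spanning_configuration s \<beta>"
  shows "uniform_maximal_rank s \<beta> \<longleftrightarrow>
    (\<exists>\<Lambda> :: nat \<Rightarrow> complex ^ 'k \<Rightarrow> complex.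
       spanning_configuration (m + s) \<Lambda> \<and>
       uniform_maximal_rank (m + s) \<Lambda> \<and>
       poincare_domain (m + s) \<Lambda> \<and>
       (\<exists>\<phi>. linear_identification \<phi> (common_kernel \<Lambda> {1..m}) \<and>
            (\<forall>j\<in>{1..s}. \<forall>x :: complex ^ 'd. \<Lambda> (m + j) (\<phi> x) = \<beta> j x)))"
    (is "_ \<longleftrightarrow> ?ext")
proof
  have beta: "\<forall>j\<in>{1..s}. \<beta> j \<in> dual_space"
    using assms(4) by (simp add: spanning_configuration_def)
  show "uniform_maximal_rank s \<beta>" if ?ext
  proof -
    from that obtain \<Lambda> :: "nat \<Rightarrow> complex ^ 'k \<Rightarrow> complex" and \<phi>
      where "spanning_configuration (m + s) \<Lambda>" "uniform_maximal_rank (m + s) \<Lambda>"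
        "linear_identification \<phi> (common_kernel \<Lambda> {1..m})"
        "\<forall>j\<in>{1..s}. \<forall>x. \<Lambda> (m + j) (\<phi> x) = \<beta> j x"
      by (elim exE conjE)
    then show ?thesis
      by (intro uniform_maximal_rank_residual[OF assms(2) beta, of \<Lambda> \<phi>])
        (simp_all add: spanning_configuration_def linear_identification_def bij_betw_def)
  qed
  assume umr: "uniform_maximal_rank s \<beta>"
  have "CARD('d) \<le> CARD('k)"
    using assms(2) by simp
  \<comment> \<open>\<open>h\<close> embeds the coordinates of the small space among those of the
    large one, and \<open>g\<close> numbers the \<open>m\<close> coordinates left over. Thus
    \<open>e i\<close> reads a leftover coordinate, \<open>B j\<close> extends
    \<open>\<beta> j\<close> by ignoring these, and \<open>\<phi>\<close> is extension by
    zero.\<close>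
  then obtain h :: "'d \<Rightarrow> 'k" where h: "inj h"
    using card_le_inj[OF finite finite] by blast
  have "card (- range h) = m"
    using h assms(2) by (simp add: Compl_eq_Diff_UNIV card_Diff_subset card_image)
  then obtain g where g: "bij_betw g {1..m} (- range h)"
    using finite_same_card_bij[of "{1..m}" "- range h"] by auto
  then have g_im: "g ` {1..m} = - range h" and g_inj: "inj_on g {1..m}"
    by (auto simp: bij_betw_def)
  define e :: "nat \<Rightarrow> complex ^ 'k \<Rightarrow> complex" where "e i x = x $ g i" for i x
  define B :: "nat \<Rightarrow> complex ^ 'k \<Rightarrow> complex" where "B j x = \<beta> j (\<chi> p. x $ h p)" for j x
  define \<phi> :: "complex ^ 'd \<Rightarrow> complex ^ 'k" where
    "\<phi> y = (\<chi> q. if q \<in> range h then y $ inv h q else 0)" for y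
  have phi_h: "(\<chi> p. \<phi> y $ h p) = y" for y
    using h by (simp add: \<phi>_def vec_eq_iff)
  have g_notin: "g i \<notin> range h" if "i \<in> {1..m}" for i
    using g_im that by blast
  have phi_g: "\<phi> y $ g i = 0" if "i \<in> {1..m}" for i y
    using g_notin[OF that] by (simp add: \<phi>_def)
  have "functional.independent_family e {1..m}"
  proof -
    have "e ` {1..m} = (\<lambda>i x. x $ i) ` g ` {1..m}"
      by (simp add: image_image e_def[abs_def])
    moreover have "inj_on e {1..m}"
      using comp_inj_on[OF g_inj inj_on_subset[OF inj_coordinates subset_UNIV]]
      by (simp add: e_def[abs_def] comp_def)
    moreover have "\<not> functional.dependent ((\<lambda>i (x :: complex ^ 'k). x $ i) ` g ` {1..m})"
      using independent_family_coordinates functional.independent_family_iff by blast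
    ultimately show ?thesis
      by (simp add: functional.independent_family_iff)
  qed
  moreover have "e i \<circ> \<phi> = 0" if "i \<in> {1..m}" for i
    using phi_g[OF that] by (auto simp: e_def)
  moreover have "B j \<circ> \<phi> = \<beta> j" for j
    by (auto simp: B_def phi_h)
  \<comment> \<open>Positive real coefficients will give the Poincare domain condition.\<close>
  moreover have "infinite (complex_of_real ` {0<..})"
    by (simp add: finite_image_iff inj_on_def infinite_Ioi)
  moreover have "functional.independent_family \<beta> K" if "K \<subseteq> {1..s}" "card K \<le> CARD('d)" for K
    using umr that unfolding uniform_maximal_rank_iff[OF beta] by blast
  ultimately have "\<exists>\<Lambda>. (\<forall>i\<in>{1..m}. \<Lambda> i = e i) \<and>
    (\<forall>j\<in>{1..s}. \<exists>c. (\<forall>i\<in>{1..m}. c i \<in> complex_of_real ` {0<..}) \<and>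
      \<Lambda> (m + j) = B j + (\<Sum>i\<in>{1..m}. fun_scale (c i) (e i))) \<and>
    (\<forall>I\<subseteq>{1..m + s}. card I \<le> CARD('k) \<longrightarrow> functional.independent_family \<Lambda> I)"
    by (intro generic_extension[OF assms(2), of e \<phi> s B \<beta>]) blast+
  then obtain \<Lambda> where \<Lambda>: "\<forall>i\<in>{1..m}. \<Lambda> i = e i"
    "\<forall>j\<in>{1..s}. \<exists>c. (\<forall>i\<in>{1..m}. c i \<in> complex_of_real ` {0<..}) \<and>
      \<Lambda> (m + j) = B j + (\<Sum>i\<in>{1..m}. fun_scale (c i) (e i))"
    and fam: "\<forall>I\<subseteq>{1..m + s}. card I \<le> CARD('k) \<longrightarrow> functional.independent_family \<Lambda> I"
    by (elim exE conjE)
  note base = \<Lambda>(1)[rule_format] and shape = \<Lambda>(2)[rule_format]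
  have index_cases: "(\<exists>j\<in>{1..s}. i = m + j) \<or> i \<in> {1..m}" if "i \<in> {1..m + s}" for i
  proof (cases "i \<le> m")
    case False
    then have "i = m + (i - m)" "i - m \<in> {1..s}"
      using that by auto
    then show ?thesis by blast
  qed (use that in simp)
  have e_dual: "e i \<in> dual_space" for i
    unfolding e_def[abs_def] by (rule coordinate_mem_dual_space)
  have B_dual: "B j \<in> dual_space" if "j \<in> {1..s}" for j
  proof -
    have "(\<chi> p. (x + y) $ h p) = (\<chi> p. x $ h p) + (\<chi> p. y $ h p)"
      "(\<chi> p. (c *s x) $ h p) = c *s (\<chi> p. x $ h p)" for c and x y :: "complex ^ 'k"
      by (simp_all add: vec_eq_iff)
    then show ?thesis
      using beta that by (simp add: B_def dual_space_iff)
  qed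
  have Lam: "\<forall>i\<in>{1..m + s}. \<Lambda> i \<in> dual_space"
  proof
    fix i assume "i \<in> {1..m + s}"
    from index_cases[OF this] show "\<Lambda> i \<in> dual_space"
    proof
      assume "\<exists>j\<in>{1..s}. i = m + j"
      then obtain j where j: "j \<in> {1..s}" "i = m + j" by blast
      then obtain c where "\<Lambda> i = B j + (\<Sum>i\<in>{1..m}. fun_scale (c i) (e i))"
        using shape by blast
      then show ?thesis
        using e_dual B_dual[OF j(1)] subspace_dual_space
        by (auto intro!: functional.subspace_add functional.subspace_sum functional.subspace_scale)
    qed (simp add: base e_dual)
  qed
  \<comment> \<open>The first \<open>CARD('k)\<close> indices are available because
    \<open>CARD('d)\<close> is at most \<open>s\<close>.\<close>
  have "functional.span (\<Lambda> ` {1..m + s}) = dual_space"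
    using fam assms(2,3)
    by (intro span_image_eq_dual_space[OF Lam, of "{1..CARD('k)}"]) auto
  then have "spanning_configuration (m + s) \<Lambda>"
    using Lam by (simp add: spanning_configuration_def)
  moreover have "uniform_maximal_rank (m + s) \<Lambda>"
    using fam by (simp add: uniform_maximal_rank_iff[OF Lam])
  moreover have "poincare_domain (m + s) \<Lambda>"
    unfolding poincare_domain_def
  proof (intro exI ballI)
    fix i assume i: "i \<in> {1..m + s}"
    \<comment> \<open>\<open>\<xi>\<close> is 1 on the leftover coordinates and 0 on the others:
      each \<open>e i\<close> takes the value 1, each \<open>B j\<close> vanishes, and
      \<open>\<Lambda> (m + j)\<close> yields the sum of its coefficients.\<close>
    define \<xi> :: "complex ^ 'k" where "\<xi> = (\<chi> q. if q \<in> range h then 0 else 1)"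
    have e_xi: "e i \<xi> = 1" if "i \<in> {1..m}" for i
      using g_notin[OF that] by (simp add: e_def \<xi>_def)
    have "(\<chi> p. \<xi> $ h p) = 0"
      by (simp add: \<xi>_def vec_eq_iff)
    then have B_xi: "B j \<xi> = 0" if "j \<in> {1..s}" for j
      using dual_space_zero[OF beta[rule_format, OF that]] by (simp add: B_def)
    from index_cases[OF i] show "Re (\<Lambda> i \<xi>) > 0"
    proof
      assume "\<exists>j\<in>{1..s}. i = m + j"
      then obtain j where j: "j \<in> {1..s}" "i = m + j" by blast
      then obtain c where c: "\<forall>i\<in>{1..m}. c i \<in> complex_of_real ` {0<..}"
        and Lam_i: "\<Lambda> i = B j + (\<Sum>i\<in>{1..m}. fun_scale (c i) (e i))"
        using shape by blast
      have "Re (\<Lambda> i \<xi>) = (\<Sum>i\<in>{1..m}. Re (c i))"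
        using e_xi B_xi[OF j(1)] by (simp add: Lam_i sum_fun_apply fun_scale_def)
      also have "\<dots> > 0"
      \<comment> \<open>Strict positivity needs a nonempty sum, which \<open>m \<ge> 1\<close>
        provides.\<close>
      proof (rule sum_pos)
        show "Re (c i) > 0" if "i \<in> {1..m}" for i
          using bspec[OF c that] by auto
      qed (use assms(1) in auto)
      finally show ?thesis .
    qed (simp add: base e_xi)
  qed
  moreover have "linear_identification \<phi> (common_kernel \<Lambda> {1..m})"
    unfolding linear_identification_def
  proof
    show "Vector_Spaces.linear (*s) (*s) \<phi>"
      by (auto simp: Vector_Spaces.linear_iff vec.vector_space_axioms vec_eq_iff \<phi>_def)
    \<comment> \<open>On the common kernel all leftover coordinates vanish, so a vector is recovered
      from its coordinates in \<open>range h\<close>.\<close>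
    have "\<exists>y. x = \<phi> y" if "x \<in> common_kernel \<Lambda> {1..m}" for x
    proof (intro exI[of _ "\<chi> p. x $ h p"])
      have "x $ q = 0" if q: "q \<notin> range h" for q
      proof -
        obtain i where i: "i \<in> {1..m}" "q = g i"
          using g_im q by blast
        then have "\<Lambda> i x = 0"
          using \<open>x \<in> common_kernel \<Lambda> {1..m}\<close> by (simp add: common_kernel_def)
        then show ?thesis
          using i base by (simp add: e_def)
      qed
      then show "x = \<phi> (\<chi> p. x $ h p)"
        using h by (auto simp: \<phi>_def vec_eq_iff)
    qed
    moreover have "\<phi> y \<in> common_kernel \<Lambda> {1..m}" for y
      using base phi_g by (simp add: common_kernel_def e_def)
    ultimately have "range \<phi> = common_kernel \<Lambda> {1..m}"
      by blast
    moreover have "inj \<phi>"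
      using phi_h by (metis injI)
    ultimately show "bij_betw \<phi> UNIV (common_kernel \<Lambda> {1..m})"
      by (simp add: bij_betw_def)
  qed
  moreover have "\<forall>j\<in>{1..s}. \<forall>x. \<Lambda> (m + j) (\<phi> x) = \<beta> j x"
  proof (intro ballI allI)
    fix j x assume "j \<in> {1..s}"
    then obtain c where "\<Lambda> (m + j) = B j + (\<Sum>i\<in>{1..m}. fun_scale (c i) (e i))"
      using shape by blast
    moreover have "e i (\<phi> x) = 0" if "i \<in> {1..m}" for i
      using phi_g[OF that] by (simp add: e_def)
    moreover have "B j (\<phi> x) = \<beta> j x"
      by (simp add: B_def phi_h)
    ultimately show "\<Lambda> (m + j) (\<phi> x) = \<beta> j x"
      by (simp add: sum_fun_apply fun_scale_def)
  qed
  ultimately show ?ext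
    by (intro exI[of _ \<Lambda>] exI[of _ \<phi>] conjI)
qed

end
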